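(* Let $(\bar\gamma,\bar\tau)\in U_{\mathrm{ad}}\times[3r,T]$ and let $(\bar\lambda,\bar\mu)\in H^1(0,T)^\star\times\mathbb{R}$ be a Lagrange multiplier at $(\bar\gamma,\bar\tau)$ (in particular $\bar\lambda\in\mathcal{N}_K(G(\bar\gamma))$). Then the multiplier $\bar\lambda$ is a positive (i.e. non-negative) Radon measure on the compact interval $[0,T]$; that is, there is a non-negative Radon measure $m$ on $[0,T]$ with $\langle\bar\lambda,v\rangle=\int_{[0,T]}v\,dm$ for all $v\in H^1(0,T)$.
   Context: Setting. $\Omega\subset\mathbb{R}^3$ is a bounded Lipschitz domain with boundary $\Gamma=\bar\Gamma_1\cup\bar\Gamma_2\cup\bar\Gamma_3$, where $\Gamma_1,\Gamma_2,\Gamma_3$ are disjoint open subsets of $\Gamma$; $\Gamma_1$ lies in the plane $\{x_3=0\}$, identified with $\mathbb{R}^2$, and every $x\in\Omega$ with $(x_1,x_2)\in\Gamma_1$ has $x_3<0$. $T>0$, $r\in\,]0,T/3[$; $Q=\Omega\times]0,T[$, $\Sigma_i=\Gamma_i\times]0,T[$. $\Gamma_S\subset\Gamma_1$ is a non-empty compact set and $\Gamma_S=\{x\in\mathbb{R}^2: g(x)\le 0\}$ for a function $g:\mathbb{R}^2\to\mathbb{R}$ of class $C^3$ with $g'(x)\ne0$ whenever $g(x)=0$. The set of admissible paths is $U_{\mathrm{ad}}=\{\gamma\in H^1(0,T;\mathbb{R}^2): g(\gamma(t))\le0\ \forall t\in[0,T]\}$. State equation. $\rho,c,\kappa,h,\alpha,P,R>0$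 are constants, $y_0\in L^2(\Omega)$, $y_B\in L^2(\Sigma_3)$. $W(0,T)=\{u\in L^2(0,T;H^1(\Omega)): u'\in L^2(0,T;H^1(\Omega)^\star)\}$. For $\gamma\in H^1(0,T;\mathbb{R}^2)$ let $g_\gamma(x,t)=\alpha\frac{2P}{\pi R^2}\exp(-2|x-\gamma(t)|^2/R^2)$, $(x,t)\in\Sigma_1$, and let $S(\gamma)=y_\gamma\in W(0,T)$ be the unique weak solution of $\rho c\,\partial_t y-\kappa\Delta y=0$ in $Q$, $-\kappa\partial_\nu y=hy-g_\gamma$ on $\Sigma_1$, $-\kappa\partial_\nu y=hy$ on $\Sigma_2$, $-\kappa\partial_\nu y=h(y-y_B)$ on $\Sigma_3$, $y(0)=y_0$. Cost. $\lambda_Q,\lambda_\Omega,\lambda_\gamma>0$, $\beta_T\ge0$, $y_Q,y_\Omega\in C([0,T];L^2(\Omega))$. The reduced cost functional $\hat J_r:H^1(0,T;\mathbb{R}^2)\times[3r,T]\to\mathbb{R}$ is, with $y=S(\gamma)$, $$\hat J_r(\gamma,\tau)=\frac{\lambda_Q}{2r}\int_{\frac\tau2-\frac r2}^{\frac\tau2+\frac r2}\!\int_\Omega|y-y_Q|^2dx\,dt+\frac{\lambda_\Omega}{2r}\int_{\tau-r}^{\tau}\!\int_\Omega|y-y_\Omega|^2dx\,dt+\frac12\int_0^T\!\!\int_\Omega|\nabla y|^2dx\,dt+\frac{\lambda_\gamma}{2}\int_0^T|\dot\gamma|^2dt+\beta_T\tau.$$ It is known to be continuously Fréchet differentiable ($\tau$-derivatives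 at $\tau=3r$ and $\tau=T$ are one-sided). Constraint, multipliers. $G:H^1(0,T;\mathbb{R}^2)\to H^1(0,T)$, $G(\gamma)=g\circ\gamma$; $K=\{v\in H^1(0,T): v\le0\}$. For a closed convex set $C$ in a Banach space $Y$ and $y\in C$, $\mathcal{N}_C(y)=\{\ell\in Y^\star:\langle\ell,z-y\rangle\le0\ \forall z\in C\}$. A pair $(\bar\lambda,\bar\mu)\in H^1(0,T)^\star\times\mathbb{R}$ is a Lagrange multiplier at $(\bar\gamma,\bar\tau)\in U_{\mathrm{ad}}\times[3r,T]$ if $\bar\lambda\in\mathcal{N}_K(G(\bar\gamma))$, $\bar\mu\in\mathcal{N}_{[3r,T]}(\bar\tau)$, $D_\gamma\hat J_r(\bar\gamma,\bar\tau)+DG(\bar\gamma)^\star\bar\lambda=0$ and $D_\tau\hat J_r(\bar\gamma,\bar\tau)+\bar\mu=0$. *)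

theory Defs
  imports "HOL-Analysis.Analysis" "HOL-Library.Function_Algebras"
begin

text \<open>
  Function spaces are carrier sets of functions together with a seminorm, both passed explicitly.
  Elements are representatives, not equivalence classes. Nothing is lost: a functional that is linear
  on the carrier and bounded by the seminorm gives the same value on two representatives of the same class.
\<close>

section \<open>Functions as vectors, seminormed carriers\<close>

instantiation "fun" :: (type, real_vector) real_vector
begin
definition scaleR_fun_def: "scaleR c f = (\<lambda>x. scaleR c (f x))"
instance
  by standard (auto simp: scaleR_fun_def fun_eq_iff scaleR_add_right scaleR_add_left)
end

definition bounded_linear_between ::
  "'v::real_vector set \<Rightarrow> ('v \<Rightarrow> real) \<Rightarrow> 'w::real_vector set \<Rightarrow> ('w \<Rightarrow> real) \<Rightarrow> ('v \<Rightarrow> 'w) \<Rightarrow> bool" where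
  "bounded_linear_between V N W M L \<longleftrightarrow>
     (\<forall>v\<in>V. L v \<in> W) \<and>
     (\<forall>u\<in>V. \<forall>v\<in>V. L (u + v) = L u + L v) \<and>
     (\<forall>c. \<forall>v\<in>V. L (c *\<^sub>R v) = c *\<^sub>R L v) \<and>
     (\<exists>C. \<forall>v\<in>V. M (L v) \<le> C * N v)"

definition dual :: "'v::real_vector set \<Rightarrow> ('v \<Rightarrow> real) \<Rightarrow> ('v \<Rightarrow> real) set" where
  "dual V N = {l. bounded_linear_between V N UNIV norm l}"

definition dual_norm :: "'v set \<Rightarrow> ('v \<Rightarrow> real) \<Rightarrow> ('v \<Rightarrow> real) \<Rightarrow> real" where
  "dual_norm V N l = (SUP v\<in>{v\<in>V. N v \<le> 1}. \<bar>l v\<bar>)"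

definition has_frechet_derivative ::
  "'v::real_vector set \<Rightarrow> ('v \<Rightarrow> real) \<Rightarrow> 'w::real_vector set \<Rightarrow> ('w \<Rightarrow> real) \<Rightarrow>
   ('v \<Rightarrow> 'w) \<Rightarrow> ('v \<Rightarrow> 'w) \<Rightarrow> 'v \<Rightarrow> bool" where
  "has_frechet_derivative V N W M F L x \<longleftrightarrow>
     bounded_linear_between V N W M L \<and>
     (\<forall>\<epsilon>>0. \<exists>\<delta>>0. \<forall>h\<in>V. N h < \<delta> \<longrightarrow> M (F (x + h) - F x - L h) \<le> \<epsilon> * N h)"

text \<open>The normal cone is empty at points outside \<open>C\<close>.\<close>

definition normal_cone ::
  "'v::real_vector set \<Rightarrow> ('v \<Rightarrow> real) \<Rightarrow> 'v set \<Rightarrow> 'v \<Rightarrow> ('v \<Rightarrow> real) set" where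
  "normal_cone V N C y = {l \<in> dual V N. y \<in> C \<and> (\<forall>z\<in>C. l (z - y) \<le> 0)}"


section \<open>Smooth functions, \<open>L\<^sup>2\<close>, \<open>H\<^sup>1\<close>\<close>

primrec C_k :: "nat \<Rightarrow> ('a::euclidean_space \<Rightarrow> 'b::real_normed_vector) \<Rightarrow> bool" where
  "C_k 0 f \<longleftrightarrow> continuous_on UNIV f"
| "C_k (Suc k) f \<longleftrightarrow>
     f differentiable_on UNIV \<and> (\<forall>i\<in>Basis. C_k k (\<lambda>x. frechet_derivative f (at x) i))"

definition smooth :: "('a::euclidean_space \<Rightarrow> 'b::real_normed_vector) \<Rightarrow> bool" where
  "smooth f \<longleftrightarrow> (\<forall>k. C_k k f)"

definition test_functions :: "'a::euclidean_space set \<Rightarrow> ('a \<Rightarrow> real) set" where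
  "test_functions D = {\<phi>. smooth \<phi> \<and> (\<exists>C. compact C \<and> C \<subseteq> D \<and> (\<forall>x. x \<notin> C \<longrightarrow> \<phi> x = 0))}"

definition L2 :: "'a measure \<Rightarrow> ('a \<Rightarrow> 'b::euclidean_space) set" where
  "L2 M = {f \<in> borel_measurable M. integrable M (\<lambda>x. (norm (f x))\<^sup>2)}"

definition L2_norm :: "'a measure \<Rightarrow> ('a \<Rightarrow> 'b::euclidean_space) \<Rightarrow> real" where
  "L2_norm M f = sqrt (LINT x|M. (norm (f x))\<^sup>2)"

definition is_weak_deriv ::
  "'a::euclidean_space set \<Rightarrow> 'a \<Rightarrow> ('a \<Rightarrow> 'b::euclidean_space) \<Rightarrow> ('a \<Rightarrow> 'b) \<Rightarrow> bool" where
  "is_weak_deriv D i u w \<longleftrightarrow>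
     (\<forall>\<phi>\<in>test_functions D.
        (LINT x|lebesgue_on D. frechet_derivative \<phi> (at x) i *\<^sub>R u x)
        = - (LINT x|lebesgue_on D. \<phi> x *\<^sub>R w x))"

definition H1 :: "'a::euclidean_space set \<Rightarrow> ('a \<Rightarrow> 'b::euclidean_space) set" where
  "H1 D = {u \<in> L2 (lebesgue_on D). \<forall>i\<in>Basis. \<exists>w\<in>L2 (lebesgue_on D). is_weak_deriv D i u w}"

definition weak_deriv ::
  "'a::euclidean_space set \<Rightarrow> 'a \<Rightarrow> ('a \<Rightarrow> 'b::euclidean_space) \<Rightarrow> 'a \<Rightarrow> 'b" where
  "weak_deriv D i u = (SOME w. w \<in> L2 (lebesgue_on D) \<and> is_weak_deriv D i u w)"

definition H1_norm :: "'a::euclidean_space set \<Rightarrow> ('a \<Rightarrow> 'b::euclidean_space) \<Rightarrow> real" where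
  "H1_norm D u =
     sqrt ((LINT x|lebesgue_on D. (norm (u x))\<^sup>2)
           + (\<Sum>i\<in>Basis. LINT x|lebesgue_on D. (norm (weak_deriv D i u x))\<^sup>2))"

text \<open>
  \<open>H\<^sup>1(0,T)\<close> is represented by continuous representatives on the closed interval, so that pointwise
  conditions and integrals against measures with atoms make sense.
  Values outside \<open>[0,T]\<close> are irrelevant.
\<close>

definition H1_interval :: "real \<Rightarrow> (real \<Rightarrow> 'b::euclidean_space) set" where
  "H1_interval T = {v. continuous_on {0..T} v \<and> v \<in> H1 {0<..<T}}"

abbreviation H1_interval_norm :: "real \<Rightarrow> (real \<Rightarrow> 'b::euclidean_space) \<Rightarrow> real" where
  "H1_interval_norm T \<equiv> H1_norm {0<..<T}"


section \<open>Functions of time with values in a seminormed carrier\<close>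

definition strongly_measurable ::
  "real set \<Rightarrow> 'v::real_vector set \<Rightarrow> ('v \<Rightarrow> real) \<Rightarrow> (real \<Rightarrow> 'v) \<Rightarrow> bool" where
  "strongly_measurable I V N u \<longleftrightarrow>
     (\<exists>s :: nat \<Rightarrow> real \<Rightarrow> 'v.
        (\<forall>n. finite (s n ` I) \<and> s n ` I \<subseteq> V \<and> (\<forall>a. {t \<in> I. s n t = a} \<in> sets lebesgue)) \<and>
        (AE t in lebesgue_on I. (\<lambda>n. N (s n t - u t)) \<longlonglongrightarrow> 0))"

definition Bochner_L2 ::
  "real set \<Rightarrow> 'v::real_vector set \<Rightarrow> ('v \<Rightarrow> real) \<Rightarrow> (real \<Rightarrow> 'v) set" where
  "Bochner_L2 I V N =
     {u. (AE t in lebesgue_on I. u t \<in> V) \<and> strongly_measurable I V N u \<and>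
         integrable (lebesgue_on I) (\<lambda>t. (N (u t))\<^sup>2)}"

definition continuous_into ::
  "real set \<Rightarrow> 'v::real_vector set \<Rightarrow> ('v \<Rightarrow> real) \<Rightarrow> (real \<Rightarrow> 'v) set" where
  "continuous_into I V N =
     {u. \<forall>t\<in>I. u t \<in> V \<and> ((\<lambda>s. N (u s - u t)) \<longlongrightarrow> 0) (at t within I)}"

text \<open>The derivative of \<open>u\<close> in \<open>L\<^sup>2(0,T;H\<^sup>1(\<Omega>)\<^sup>*)\<close>, with \<open>H\<^sup>1(\<Omega>)\<close> embedded in its dual through \<open>L\<^sup>2(\<Omega>)\<close>.\<close>

definition is_time_deriv ::
  "real \<Rightarrow> (real^3) set \<Rightarrow> (real \<Rightarrow> real^3 \<Rightarrow> real) \<Rightarrow> (real \<Rightarrow> (real^3 \<Rightarrow> real) \<Rightarrow> real) \<Rightarrow> bool" where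
  "is_time_deriv T \<Omega> u u' \<longleftrightarrow>
     u' \<in> Bochner_L2 {0<..<T} (dual (H1 \<Omega>) (H1_norm \<Omega>)) (dual_norm (H1 \<Omega>) (H1_norm \<Omega>)) \<and>
     (\<forall>\<phi>\<in>test_functions {0<..<T}. \<forall>v\<in>H1 \<Omega>.
        (LINT t|lebesgue_on {0<..<T}. frechet_derivative \<phi> (at t) 1 * (LINT x|lebesgue_on \<Omega>. u t x * v x))
        = - (LINT t|lebesgue_on {0<..<T}. \<phi> t * u' t v))"

definition W_space :: "real \<Rightarrow> (real^3) set \<Rightarrow> (real \<Rightarrow> real^3 \<Rightarrow> real) set" where
  "W_space T \<Omega> = {u \<in> Bochner_L2 {0<..<T} (H1 \<Omega>) (H1_norm \<Omega>). \<exists>u'. is_time_deriv T \<Omega> u u'}"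


section \<open>Lipschitz domains, surface measure, traces\<close>

definition plane_part :: "real^3 \<Rightarrow> real^2" where
  "plane_part x = vector [x$1, x$2]"

definition bounded_lipschitz_domain :: "(real^3) set \<Rightarrow> bool" where
  "bounded_lipschitz_domain \<Omega> \<longleftrightarrow>
     open \<Omega> \<and> connected \<Omega> \<and> \<Omega> \<noteq> {} \<and> bounded \<Omega> \<and>
     (\<forall>p\<in>frontier \<Omega>. \<exists>U (A :: real^3 \<Rightarrow> real^3) (\<phi> :: real^2 \<Rightarrow> real) C.
        open U \<and> p \<in> U \<and> orthogonal_transformation A \<and> C-lipschitz_on UNIV \<phi> \<and>
        \<Omega> \<inter> U = {x \<in> U. A x $ 3 < \<phi> (plane_part (A x))})"

text \<open>
  The surface measure is the two-dimensional Hausdorff measure. The factor \<open>\<pi>/4\<close> normalises it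
  so that it is area on planes.
\<close>

definition hausdorff2_pre :: "real \<Rightarrow> (real^3) set \<Rightarrow> ennreal" where
  "hausdorff2_pre \<delta> A =
     (INF U\<in>{U :: nat \<Rightarrow> (real^3) set. A \<subseteq> (\<Union>i. U i) \<and> (\<forall>i. bounded (U i) \<and> diameter (U i) \<le> \<delta>)}.
        \<Sum>i. ennreal (pi / 4 * (diameter (U i))\<^sup>2))"

definition hausdorff2 :: "(real^3) measure" where
  "hausdorff2 = measure_of UNIV (sets borel) (\<lambda>A. SUP \<delta>\<in>{0<..}. hausdorff2_pre \<delta> A)"

definition surface :: "(real^3) set \<Rightarrow> (real^3) measure" where
  "surface S = restrict_space hausdorff2 S"

text \<open>
  The trace on the boundary is the continuous extension of restriction from functions smooth on the
  closure, which are dense in \<open>H\<^sup>1(\<Omega>)\<close> for a bounded Lipschitz domain.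
\<close>

definition is_trace :: "(real^3) set \<Rightarrow> (real^3 \<Rightarrow> real) \<Rightarrow> (real^3 \<Rightarrow> real) \<Rightarrow> bool" where
  "is_trace \<Omega> u w \<longleftrightarrow>
     w \<in> L2 (surface (frontier \<Omega>)) \<and>
     (\<exists>\<phi> :: nat \<Rightarrow> real^3 \<Rightarrow> real.
        (\<forall>n. smooth (\<phi> n)) \<and>
        (\<lambda>n. H1_norm \<Omega> (\<phi> n - u)) \<longlonglongrightarrow> 0 \<and>
        (\<lambda>n. L2_norm (surface (frontier \<Omega>)) (\<phi> n - w)) \<longlonglongrightarrow> 0)"

definition boundary_trace :: "(real^3) set \<Rightarrow> (real^3 \<Rightarrow> real) \<Rightarrow> real^3 \<Rightarrow> real" where
  "boundary_trace \<Omega> u = (SOME w. is_trace \<Omega> u w)"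


section \<open>The control problem\<close>

record problem =
  Omega :: "(real^3) set"
  Gamma1 :: "(real^3) set"
  Gamma2 :: "(real^3) set"
  Gamma3 :: "(real^3) set"
  final_time :: real
  win_length :: real  \<comment> \<open>the parameter \<open>r\<close>, length of the two averaging windows in the cost\<close>
  GammaS :: "(real^2) set"
  g_fun :: "real^2 \<Rightarrow> real"
  density :: real
  heat_capacity :: real
  conductivity :: real
  transfer_coeff :: real
  absorption :: real
  power :: real
  beam_radius :: real
  y_init :: "real^3 \<Rightarrow> real"
  y_bdry :: "(real^3) \<times> real \<Rightarrow> real"
  lam_Q :: real
  lam_Omega :: real
  lam_path :: real
  beta_T :: real
  y_Q :: "real \<Rightarrow> real^3 \<Rightarrow> real"
  y_Omega :: "real \<Rightarrow> real^3 \<Rightarrow> real"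

definition standing_assumptions :: "problem \<Rightarrow> bool" where
  "standing_assumptions d \<longleftrightarrow>
     bounded_lipschitz_domain (Omega d) \<and>
     (\<forall>S\<in>{Gamma1 d, Gamma2 d, Gamma3 d}. openin (top_of_set (frontier (Omega d))) S) \<and>
     Gamma1 d \<inter> Gamma2 d = {} \<and> Gamma1 d \<inter> Gamma3 d = {} \<and> Gamma2 d \<inter> Gamma3 d = {} \<and>
     frontier (Omega d) = closure (Gamma1 d) \<union> closure (Gamma2 d) \<union> closure (Gamma3 d) \<and>
     Gamma1 d \<subseteq> {x. x$3 = 0} \<and>
     (\<forall>x\<in>Omega d. plane_part x \<in> plane_part ` Gamma1 d \<longrightarrow> x$3 < 0) \<and>
     0 < final_time d \<and> 0 < win_length d \<and> win_length d < final_time d / 3 \<and>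
     GammaS d \<noteq> {} \<and> compact (GammaS d) \<and> GammaS d \<subseteq> plane_part ` Gamma1 d \<and>
     GammaS d = {x. g_fun d x \<le> 0} \<and>
     C_k 3 (g_fun d) \<and>
     (\<forall>x. g_fun d x = 0 \<longrightarrow> frechet_derivative (g_fun d) (at x) \<noteq> (\<lambda>_. 0)) \<and>
     0 < density d \<and> 0 < heat_capacity d \<and> 0 < conductivity d \<and> 0 < transfer_coeff d \<and>
     0 < absorption d \<and> 0 < power d \<and> 0 < beam_radius d \<and>
     y_init d \<in> L2 (lebesgue_on (Omega d)) \<and>
     y_bdry d \<in> L2 (surface (Gamma3 d) \<Otimes>\<^sub>M lebesgue_on {0<..<final_time d}) \<and>
     0 < lam_Q d \<and> 0 < lam_Omega d \<and> 0 < lam_path d \<and> 0 \<le> beta_T d \<and>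
     y_Q d \<in> continuous_into {0..final_time d}
               (L2 (lebesgue_on (Omega d))) (L2_norm (lebesgue_on (Omega d))) \<and>
     y_Omega d \<in> continuous_into {0..final_time d}
               (L2 (lebesgue_on (Omega d))) (L2_norm (lebesgue_on (Omega d)))"

definition U_ad :: "problem \<Rightarrow> (real \<Rightarrow> real^2) set" where
  "U_ad d = {\<gamma> \<in> H1_interval (final_time d). \<forall>t\<in>{0..final_time d}. g_fun d (\<gamma> t) \<le> 0}"

definition heat_source :: "problem \<Rightarrow> (real \<Rightarrow> real^2) \<Rightarrow> real^3 \<Rightarrow> real \<Rightarrow> real" where
  "heat_source d \<gamma> x t =
     absorption d * (2 * power d / (pi * (beam_radius d)\<^sup>2))
     * exp (- 2 * (norm (plane_part x - \<gamma> t))\<^sup>2 / (beam_radius d)\<^sup>2)"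

text \<open>
  Weak form of the state equation, obtained by testing with \<open>v \<in> H\<^sup>1(\<Omega>)\<close> and inserting the
  boundary conditions into \<open>\<kappa> \<integral> (\<partial>\<^sub>\<nu> y) v\<close>. The initial value is that of the representative
  of \<open>y\<close> in \<open>C([0,T];L\<^sup>2(\<Omega>))\<close>.
\<close>

definition weak_solution :: "problem \<Rightarrow> (real \<Rightarrow> real^2) \<Rightarrow> (real \<Rightarrow> real^3 \<Rightarrow> real) \<Rightarrow> bool" where
  "weak_solution d \<gamma> y \<longleftrightarrow>
     (let \<Omega> = Omega d; T = final_time d; h = transfer_coeff d; tr = boundary_trace \<Omega> in
      y \<in> W_space T \<Omega> \<and>
      (\<exists>y'. is_time_deriv T \<Omega> y y' \<and>
        (AE t in lebesgue_on {0<..<T}. \<forall>v\<in>H1 \<Omega>.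
           density d * heat_capacity d * y' t v
           + conductivity d *
               (LINT x|lebesgue_on \<Omega>. (\<Sum>i\<in>Basis. weak_deriv \<Omega> i (y t) x * weak_deriv \<Omega> i v x))
           + (\<Sum>S\<leftarrow>[Gamma1 d, Gamma2 d, Gamma3 d]. LINT x|surface S. h * tr (y t) x * tr v x)
           = (LINT x|surface (Gamma1 d). heat_source d \<gamma> x t * tr v x)
             + (LINT x|surface (Gamma3 d). h * y_bdry d (x, t) * tr v x))) \<and>
      (\<exists>z\<in>continuous_into {0..T} (L2 (lebesgue_on \<Omega>)) (L2_norm (lebesgue_on \<Omega>)).
         (AE t in lebesgue_on {0<..<T}. AE x in lebesgue_on \<Omega>. y t x = z t x) \<and>
         (AE x in lebesgue_on \<Omega>. z 0 x = y_init d x)))"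

text \<open>The weak solution is unique up to null sets, which do not affect the cost.\<close>

definition state :: "problem \<Rightarrow> (real \<Rightarrow> real^2) \<Rightarrow> real \<Rightarrow> real^3 \<Rightarrow> real" where
  "state d \<gamma> = (SOME y. weak_solution d \<gamma> y)"

definition reduced_cost :: "problem \<Rightarrow> (real \<Rightarrow> real^2) \<Rightarrow> real \<Rightarrow> real" where
  "reduced_cost d \<gamma> \<tau> =
     (let \<Omega> = Omega d; T = final_time d; r = win_length d; y = state d \<gamma> in
      lam_Q d / (2 * r) *
        (LINT t|lebesgue_on {\<tau>/2 - r/2 .. \<tau>/2 + r/2}. LINT x|lebesgue_on \<Omega>. (y t x - y_Q d t x)\<^sup>2)
      + lam_Omega d / (2 * r) *
        (LINT t|lebesgue_on {\<tau> - r .. \<tau>}. LINT x|lebesgue_on \<Omega>. (y t x - y_Omega d t x)\<^sup>2)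
      + 1 / 2 *
        (LINT t|lebesgue_on {0<..<T}. LINT x|lebesgue_on \<Omega>. (\<Sum>i\<in>Basis. (weak_deriv \<Omega> i (y t) x)\<^sup>2))
      + lam_path d / 2 * (LINT t|lebesgue_on {0<..<T}. (norm (weak_deriv {0<..<T} 1 \<gamma> t))\<^sup>2)
      + beta_T d * \<tau>)"

definition path_constraint :: "problem \<Rightarrow> (real \<Rightarrow> real^2) \<Rightarrow> real \<Rightarrow> real" where
  "path_constraint d \<gamma> = g_fun d \<circ> \<gamma>"

definition nonpos_cone :: "problem \<Rightarrow> (real \<Rightarrow> real) set" where
  "nonpos_cone d = {v \<in> H1_interval (final_time d). \<forall>t\<in>{0..final_time d}. v t \<le> 0}"

text \<open>
  The dual of the reals is identified with the reals through multiplication. The derivatives are partial;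
  the one in \<open>\<tau>\<close> is one-sided at the end points of \<open>[3r,T]\<close>.
\<close>

definition lagrange_multiplier ::
  "problem \<Rightarrow> (real \<Rightarrow> real^2) \<Rightarrow> real \<Rightarrow> ((real \<Rightarrow> real) \<Rightarrow> real) \<Rightarrow> real \<Rightarrow> bool" where
  "lagrange_multiplier d \<gamma> \<tau> lam \<mu> \<longleftrightarrow>
     (let T = final_time d; r = win_length d in
      lam \<in> normal_cone (H1_interval T) (H1_interval_norm T) (nonpos_cone d) (path_constraint d \<gamma>) \<and>
      (\<lambda>s. \<mu> * s) \<in> normal_cone UNIV norm {3 * r .. T} \<tau> \<and>
      (\<exists>DJ DG.
         has_frechet_derivative (H1_interval T) (H1_interval_norm T) UNIV norm
           (\<lambda>\<eta>. reduced_cost d \<eta> \<tau>) DJ \<gamma> \<and>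
         has_frechet_derivative (H1_interval T) (H1_interval_norm T)
           (H1_interval T) (H1_interval_norm T) (path_constraint d) DG \<gamma> \<and>
         (\<forall>\<eta>\<in>H1_interval T. DJ \<eta> + lam (DG \<eta>) = 0)) \<and>
      (\<exists>j. (reduced_cost d \<gamma> has_real_derivative j) (at \<tau> within {3 * r .. T}) \<and> j + \<mu> = 0))"


section \<open>Radon measures\<close>

definition radon_measure_on :: "'a::topological_space set \<Rightarrow> 'a measure \<Rightarrow> bool" where
  "radon_measure_on X m \<longleftrightarrow>
     sets m = sets (restrict_space borel X) \<and>
     (\<forall>C. compact C \<and> C \<subseteq> X \<longrightarrow> emeasure m C < \<infinity>) \<and>
     (\<forall>B\<in>sets m. emeasure m B = (SUP C\<in>{C. compact C \<and> C \<subseteq> B}. emeasure m C))"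

end

theory Submission
  imports Defs
begin

text \<open>
  Testing the normal cone condition with \<open>z = G(\<gamma>) - v\<close> for \<open>v \<ge> 0\<close> shows that the multiplier is
  a positive functional on \<open>H\<^sup>1(0,T)\<close>; as the constants belong to \<open>H\<^sup>1(0,T)\<close>, it is bounded by the
  supremum norm. Its values on piecewise linear ramps decreasing to the indicator of \<open>{..t}\<close> converge
  to a right-continuous distribution function, whose Stieltjes measure represents the functional:
  every continuous \<open>v\<close> is uniformly approximated by combinations of ramps, both before and after
  the passage to the limit.
\<close>

section \<open>The space \<open>H\<^sup>1(0,T)\<close>\<close>

lemma finite_measure_lebesgue_on_bounded:
  assumes "bounded D" "D \<in> sets lebesgue"
  shows "finite_measure (lebesgue_on D)"
  using assms bounded_set_imp_lmeasurable finite_measure_lebesgue_on by blast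

lemma L2_bounded:
  fixes f :: "'a \<Rightarrow> 'b::euclidean_space"
  assumes "finite_measure M" "f \<in> borel_measurable M" "\<And>x. x \<in> space M \<Longrightarrow> norm (f x) \<le> B"
  shows "f \<in> L2 M"
proof -
  interpret finite_measure M by fact
  have "integrable M (\<lambda>x. (norm (f x))\<^sup>2)"
    using assms(2,3) by (intro integrable_const_bound[where B = "B\<^sup>2"] AE_I2) (auto intro!: power_mono)
  then show ?thesis
    using assms by (simp add: L2_def)
qed

text \<open>From 2|f| <= 1 + |f|^2 the product is dominated by \<open>B\<close> times 1 + |f|^2,
  which is integrable because the measure is finite.\<close>

lemma L2_integrable_scaleR:
  fixes f :: "'a \<Rightarrow> 'b::euclidean_space"
  assumes "finite_measure M" "f \<in> L2 M" "p \<in> borel_measurable M"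
    and "\<And>x. x \<in> space M \<Longrightarrow> \<bar>p x\<bar> \<le> B"
  shows "integrable M (\<lambda>x. p x *\<^sub>R f x)"
proof -
  interpret finite_measure M by fact
  have f[measurable]: "f \<in> borel_measurable M" and sq: "integrable M (\<lambda>x. (norm (f x))\<^sup>2)"
    using assms(2) by (auto simp: L2_def)
  have "integrable M (\<lambda>x. B * (1 + (norm (f x))\<^sup>2))"
    using sq by auto
  then show ?thesis
  proof (rule Bochner_Integration.integrable_bound)
    show "(\<lambda>x. p x *\<^sub>R f x) \<in> borel_measurable M"
      using assms(3) by measurable
    show "AE x in M. norm (p x *\<^sub>R f x) \<le> norm (B * (1 + (norm (f x))\<^sup>2))"
    proof (rule AE_I2)
      fix x assume x: "x \<in> space M"
      have "0 \<le> (norm (f x) - 1)\<^sup>2"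
        by simp
      then have "2 * norm (f x) \<le> 1 + (norm (f x))\<^sup>2"
        by (simp add: power2_eq_square algebra_simps)
      then have "norm (f x) \<le> 1 + (norm (f x))\<^sup>2"
        using norm_ge_zero[of "f x"] by linarith
      then have "\<bar>p x\<bar> * norm (f x) \<le> B * (1 + (norm (f x))\<^sup>2)"
        using assms(4)[OF x] by (intro mult_mono) auto
      then show "norm (p x *\<^sub>R f x) \<le> norm (B * (1 + (norm (f x))\<^sup>2))"
        by simp
    qed
  qed
qed

lemma L2_add:
  fixes f g :: "'a \<Rightarrow> 'b::euclidean_space"
  assumes "f \<in> L2 M" "g \<in> L2 M"
  shows "f + g \<in> L2 M"
proof -
  have [measurable]: "f \<in> borel_measurable M" "g \<in> borel_measurable M"
    and i: "integrable M (\<lambda>x. 2 * (norm (f x))\<^sup>2 + 2 * (norm (g x))\<^sup>2)"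
    using assms by (auto simp: L2_def)
  from i have "integrable M (\<lambda>x. (norm (f x + g x))\<^sup>2)"
  proof (rule Bochner_Integration.integrable_bound)
    show "AE x in M. norm ((norm (f x + g x))\<^sup>2) \<le> norm (2 * (norm (f x))\<^sup>2 + 2 * (norm (g x))\<^sup>2)"
    proof (rule AE_I2)
      fix x
      have "(norm (f x + g x))\<^sup>2 \<le> (norm (f x) + norm (g x))\<^sup>2"
        by (intro power_mono norm_triangle_ineq) auto
      also have "\<dots> \<le> 2 * (norm (f x))\<^sup>2 + 2 * (norm (g x))\<^sup>2"
        using zero_le_power2[of "norm (f x) - norm (g x)"] by (simp add: power2_eq_square algebra_simps)
      finally show "norm ((norm (f x + g x))\<^sup>2) \<le> norm (2 * (norm (f x))\<^sup>2 + 2 * (norm (g x))\<^sup>2)"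
        by simp
    qed
  qed measurable
  then show ?thesis
    by (simp add: L2_def plus_fun_def)
qed

lemma L2_scaleR: "f \<in> L2 M \<Longrightarrow> c *\<^sub>R f \<in> L2 M"
  by (auto simp: L2_def scaleR_fun_def power_mult_distrib)

lemma test_function_differentiable:
  assumes "\<phi> \<in> test_functions D"
  shows "\<phi> differentiable_on UNIV"
    and "i \<in> Basis \<Longrightarrow> continuous_on UNIV (\<lambda>x. frechet_derivative \<phi> (at x) i)"
proof -
  \<comment> \<open>Order 2 makes the partial derivatives differentiable, hence continuous.\<close>
  have "C_k 2 \<phi>"
    using assms by (auto simp: test_functions_def smooth_def)
  then show "\<phi> differentiable_on UNIV"
    and "i \<in> Basis \<Longrightarrow> continuous_on UNIV (\<lambda>x. frechet_derivative \<phi> (at x) i)"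
    by (auto simp: numeral_2_eq_2 intro: differentiable_imp_continuous_on)
qed

text \<open>Applied with \<open>p\<close> a test function or one of its partial derivatives; these
  are bounded on the compact closure of \<open>D\<close>.\<close>

lemma continuous_integrable_scaleR_L2:
  fixes p :: "'a::euclidean_space \<Rightarrow> real" and f :: "'a \<Rightarrow> 'b::euclidean_space"
  assumes "bounded D" "D \<in> sets lebesgue" "continuous_on UNIV p" "f \<in> L2 (lebesgue_on D)"
  shows "integrable (lebesgue_on D) (\<lambda>x. p x *\<^sub>R f x)"
proof -
  have "compact (p ` closure D)"
    using assms(1,3) by (intro compact_continuous_image) (auto intro: continuous_on_subset)
  then obtain B where B: "\<And>x. x \<in> closure D \<Longrightarrow> \<bar>p x\<bar> \<le> B"
    by (force dest!: compact_imp_bounded simp: bounded_iff)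
  show ?thesis
  proof (rule L2_integrable_scaleR[where B = B])
    show "p \<in> borel_measurable (lebesgue_on D)"
      by (rule continuous_imp_measurable_on_sets_lebesgue[OF continuous_on_subset[OF assms(3)] assms(2)]) simp
  qed (use assms B closure_subset in \<open>auto intro: finite_measure_lebesgue_on_bounded\<close>)
qed

section \<open>Linear structure of \<open>H1\<close> and a membership criterion on the
  interval\<close>

lemma H1_add:
  fixes u v :: "'a::euclidean_space \<Rightarrow> 'b::euclidean_space"
  assumes "bounded D" "D \<in> sets lebesgue" "u \<in> H1 D" "v \<in> H1 D"
  shows "u + v \<in> H1 D"
proof -
  have L2: "u \<in> L2 (lebesgue_on D)" "v \<in> L2 (lebesgue_on D)"
    using assms by (auto simp: H1_def)
  have "\<exists>w\<in>L2 (lebesgue_on D). is_weak_deriv D i (u + v) w" if i: "i \<in> Basis" for i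
  proof -
    obtain w z where w: "w \<in> L2 (lebesgue_on D)" "is_weak_deriv D i u w"
      and z: "z \<in> L2 (lebesgue_on D)" "is_weak_deriv D i v z"
      using assms(3,4) i unfolding H1_def by blast
    have "is_weak_deriv D i (u + v) (w + z)"
      unfolding is_weak_deriv_def
    proof
      fix \<phi> assume \<phi>: "\<phi> \<in> test_functions D"
      \<comment> \<open>The integral of a sum splits only for integrable summands, so all four
        products are needed.\<close>
      note int = continuous_integrable_scaleR_L2[OF assms(1,2)]
      note c = test_function_differentiable(2)[OF \<phi> i]
        differentiable_imp_continuous_on[OF test_function_differentiable(1)[OF \<phi>]]
      show "(LINT x|lebesgue_on D. frechet_derivative \<phi> (at x) i *\<^sub>R (u + v) x)
          = - (LINT x|lebesgue_on D. \<phi> x *\<^sub>R (w + z) x)"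
        using w(2) z(2) \<phi> int[OF c(1) L2(1)] int[OF c(1) L2(2)] int[OF c(2) w(1)] int[OF c(2) z(1)]
        by (simp add: is_weak_deriv_def scaleR_add_right)
    qed
    with w z show ?thesis
      using L2_add by blast
  qed
  with L2 show ?thesis
    by (auto simp: H1_def L2_add)
qed

lemma H1_scaleR:
  fixes u :: "'a::euclidean_space \<Rightarrow> 'b::euclidean_space"
  assumes "u \<in> H1 D"
  shows "c *\<^sub>R u \<in> H1 D"
proof -
  have "is_weak_deriv D i (c *\<^sub>R u) (c *\<^sub>R w)" if "is_weak_deriv D i u w" for i w
  proof -
    \<comment> \<open>This holds without integrability, since a non-integrable integrand gives 0 on
      both sides.\<close>
    have *: "(LINT x|M. p x *\<^sub>R c *\<^sub>R f x) = c *\<^sub>R (LINT x|M. p x *\<^sub>R f x)"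
      for M :: "'a measure" and p and f :: "'a \<Rightarrow> 'b"
      by (simp only: scaleR_left_commute[of _ c] integral_scaleR_right)
    show ?thesis
      using that by (simp add: is_weak_deriv_def scaleR_fun_def * del: scaleR_scaleR)
  qed
  then show ?thesis
    using assms unfolding H1_def by (blast intro: L2_scaleR)
qed

text \<open>Source of all membership facts for constants and ramps. Integrating the derivative of
  \<phi> u shows that the pointwise derivative off finitely many corners is the weak one, because
  \<phi> vanishes at both ends.\<close>

lemma H1_bounded_piecewise_deriv:
  fixes u w :: "real \<Rightarrow> real"
  assumes "0 \<le> T" "continuous_on {0..T} u" "finite S"
    and deriv: "\<And>x. x \<in> {0<..<T} - S \<Longrightarrow> (u has_real_derivative w x) (at x)"
    and w: "w \<in> borel_measurable borel" "\<And>x. \<bar>w x\<bar> \<le> B"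
  shows "u \<in> H1_interval T"
proof -
  let ?M = "lebesgue_on {0<..<T}"
  have fin: "finite_measure ?M"
    by (intro finite_measure_lebesgue_on_bounded) auto
  have u_meas: "u \<in> borel_measurable ?M"
    by (rule continuous_imp_measurable_on_sets_lebesgue[OF continuous_on_subset[OF assms(2)]]) auto
  have "compact (u ` {0..T})"
    by (intro compact_continuous_image assms) auto
  then obtain C where C: "\<And>x. x \<in> {0..T} \<Longrightarrow> \<bar>u x\<bar> \<le> C"
    by (force dest!: compact_imp_bounded simp: bounded_iff)
  have u_L2: "u \<in> L2 ?M"
    using C by (intro L2_bounded[OF fin u_meas, where B = C]) auto
  have "w \<in> borel_measurable lebesgue"
    using w(1) by (simp add: measurable_completion)
  then have w_L2: "w \<in> L2 ?M"
    using w(2) by (intro L2_bounded[OF fin, where B = B]) (auto intro: measurable_restrict_space1)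
  have "is_weak_deriv {0<..<T} 1 u w"
    unfolding is_weak_deriv_def
  proof
    fix \<phi> :: "real \<Rightarrow> real"
    assume \<phi>: "\<phi> \<in> test_functions {0<..<T}"
    let ?d = "\<lambda>x. frechet_derivative \<phi> (at x) 1"
    have c: "continuous_on UNIV ?d" "continuous_on UNIV \<phi>"
      using test_function_differentiable[OF \<phi>] by (auto intro: differentiable_imp_continuous_on)
    have d\<phi>: "(\<phi> has_real_derivative ?d x) (at x)" for x
    proof -
      have "\<phi> differentiable at x"
        using test_function_differentiable(1)[OF \<phi>] by (simp add: differentiable_on_def)
      then have fd: "(\<phi> has_derivative frechet_derivative \<phi> (at x)) (at x)"
        by (simp add: frechet_derivative_works)
      then interpret bounded_linear "frechet_derivative \<phi> (at x)"
        by (rule has_derivative_bounded_linear)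
      \<comment> \<open>On the line a linear map is multiplication by its value at 1.\<close>
      have "frechet_derivative \<phi> (at x) = (*) (?d x)"
      proof
        fix y show "frechet_derivative \<phi> (at x) y = ?d x * y"
          using scaleR[of y 1] by (simp add: mult.commute)
      qed
      with fd show ?thesis
        by (simp add: has_field_derivative_def)
    qed
    have ends: "\<phi> 0 = 0" "\<phi> T = 0"
      using \<phi> by (force simp: test_functions_def)+
    \<comment> \<open>The product \<phi> u is continuous on the closed interval, so the fundamental
      theorem tolerates the corners in \<open>S\<close>.\<close>
    have "((\<lambda>x. ?d x * u x + \<phi> x * w x) has_integral (\<phi> T * u T - \<phi> 0 * u 0)) {0..T}"
    proof (rule fundamental_theorem_of_calculus_interior_strong[OF assms(3,1)])
      fix x assume "x \<in> {0<..<T} - S"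
      then show "((\<lambda>x. \<phi> x * u x) has_vector_derivative ?d x * u x + \<phi> x * w x) (at x)"
        unfolding has_real_derivative_iff_has_vector_derivative[symmetric]
        by (auto intro!: derivative_eq_intros d\<phi> deriv)
    qed (use c(2) assms(2) in \<open>auto intro!: continuous_intros intro: continuous_on_subset\<close>)
    then have I0: "integral {0<..<T} (\<lambda>x. ?d x * u x + \<phi> x * w x) = 0"
      unfolding has_integral_Icc_iff_Ioo by (simp add: ends integral_unique)
    have i1: "integrable ?M (\<lambda>x. ?d x * u x)" and i2: "integrable ?M (\<lambda>x. \<phi> x * w x)"
      using continuous_integrable_scaleR_L2[OF _ _ c(1) u_L2]
        continuous_integrable_scaleR_L2[OF _ _ c(2) w_L2] by auto
    have "(LINT x|?M. ?d x * u x) + (LINT x|?M. \<phi> x * w x) = (LINT x|?M. ?d x * u x + \<phi> x * w x)"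
      by (rule Bochner_Integration.integral_add[OF i1 i2, symmetric])
    \<comment> \<open>The fundamental theorem yields a Henstock-Kurzweil integral; Lebesgue
      integrability of the summands identifies the two integrals.\<close>
    also have "\<dots> = 0"
      using I0 by (subst lebesgue_integral_eq_integral[OF Bochner_Integration.integrable_add[OF i1 i2]]) auto
    finally show "(LINT x|?M. ?d x *\<^sub>R u x) = - (LINT x|?M. \<phi> x *\<^sub>R w x)"
      by simp
  qed
  with u_L2 w_L2 assms(2) show ?thesis
    by (auto simp: H1_interval_def H1_def)
qed

lemma subspace_H1_interval:
  assumes "0 \<le> T"
  shows "subspace (H1_interval T :: (real \<Rightarrow> real) set)"
  unfolding subspace_def
proof (intro conjI ballI allI)
  show "(0 :: real \<Rightarrow> real) \<in> H1_interval T"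
    unfolding zero_fun_def
    by (rule H1_bounded_piecewise_deriv[OF assms, where S = "{}" and w = "\<lambda>_. 0" and B = 0]) auto
next
  fix u v :: "real \<Rightarrow> real" assume "u \<in> H1_interval T" "v \<in> H1_interval T"
  then show "u + v \<in> H1_interval T"
    by (auto simp: H1_interval_def plus_fun_def intro: continuous_on_add
        H1_add[of "{0<..<T}" u v, unfolded plus_fun_def])
next
  fix c and u :: "real \<Rightarrow> real" assume "u \<in> H1_interval T"
  then show "c *\<^sub>R u \<in> H1_interval T"
    using H1_scaleR[of u _ c] by (auto simp: H1_interval_def scaleR_fun_def intro: continuous_on_mult_left)
qed

section \<open>Ramps\<close>

text \<open>For \<open>e = 0\<close> the ramp degenerates to the indicator of \<open>{..t}\<close>.\<close>

definition ramp :: "real \<Rightarrow> real \<Rightarrow> real \<Rightarrow> real" where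
  "ramp t e x = (if x \<le> t then 1 else if x < t + e then 1 - (x - t) / e else 0)"

text \<open>Continuity and the slope bound \<open>1 / e\<close> are read off from this form.\<close>

lemma ramp_eq_max_min:
  assumes "0 < e"
  shows "ramp t e x = max 0 (min 1 (1 - (x - t) / e))"
  using assms by (auto simp: ramp_def max_def min_def field_simps)

lemma ramp_bounds: "0 \<le> ramp t e x" "ramp t e x \<le> 1"
  by (auto simp: ramp_def field_simps)

lemma ramp_0: "ramp t 0 x = indicator {..t} x"
  by (simp add: ramp_def indicator_def)

lemma ramp_mono_left:
  assumes "s \<le> t" "0 \<le> e"
  shows "ramp s e x \<le> ramp t e x"
  using assms ramp_bounds[of t e x] ramp_bounds[of s e x]
  by (auto simp: ramp_def divide_right_mono)

text \<open>For shrinking widths this makes the values of a positive functional decrease, so that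
  they converge.\<close>

lemma ramp_mono_width:
  assumes "0 < d" "d \<le> e"
  shows "ramp t d x \<le> ramp t e x"
  using assms ramp_bounds[of t e x] ramp_bounds[of t d x]
  by (auto simp: ramp_def divide_left_mono)

text \<open>The untruncated affine functions differ by exactly \<open>d / e\<close>, and truncation
  does not increase the gap. The estimate serves the right-continuity of the distribution
  function.\<close>

lemma ramp_shift_le:
  assumes "0 < e" "0 \<le> d"
  shows "ramp (t + d) e x \<le> ramp t e x + d / e"
proof -
  have "1 - (x - (t + d)) / e = (1 - (x - t) / e) + d / e" "0 \<le> d / e"
    using assms by (auto simp: field_simps)
  then show ?thesis
    unfolding ramp_eq_max_min[OF assms(1)] by linarith
qed

lemma ramp_in_H1_interval:
  assumes "0 \<le> T" "0 < e"
  shows "ramp t e \<in> H1_interval T"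
proof (rule H1_bounded_piecewise_deriv[where S = "{t, t + e}" and B = "1 / e"
      and w = "\<lambda>x. indicator {t<..<t + e} x * (- 1 / e)"])
  show "continuous_on {0..T} (ramp t e)"
    using assms(2) unfolding ramp_eq_max_min[OF assms(2), abs_def] by (intro continuous_intros) auto
  fix x assume x: "x \<in> {0<..<T} - {t, t + e}"
  let ?w = "indicator {t<..<t + e} x * (- 1 / e)"
  consider "x < t" | "t < x" "x < t + e" | "t + e < x"
    using x by fastforce
  then show "(ramp t e has_real_derivative ?w) (at x)"
  proof cases
    case 1
    have "((\<lambda>_. 1) has_real_derivative ?w) (at x)"
      using 1 by simp
    then show ?thesis
      by (rule has_field_derivative_transform_within_open[where S = "{..<t}"]) (use 1 in \<open>auto simp: ramp_def\<close>)
  next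
    case 2
    have "((\<lambda>y. 1 - (y - t) / e) has_real_derivative ?w) (at x)"
      using 2 assms(2) by (auto intro!: derivative_eq_intros)
    then show ?thesis
      by (rule has_field_derivative_transform_within_open[where S = "{t<..<t + e}"])
        (use 2 in \<open>auto simp: ramp_def\<close>)
  next
    case 3
    have "((\<lambda>_. 0) has_real_derivative ?w) (at x)"
      using 3 by simp
    then show ?thesis
      by (rule has_field_derivative_transform_within_open[where S = "{t + e<..}"])
        (use 3 assms(2) in \<open>auto simp: ramp_def\<close>)
  qed
qed (use assms in \<open>auto simp: indicator_def\<close>)

lemma const_in_H1_interval: "0 \<le> T \<Longrightarrow> (\<lambda>_. c :: real) \<in> H1_interval T"
  by (rule H1_bounded_piecewise_deriv[where S = "{}" and w = "\<lambda>_. 0" and B = 0]) auto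

section \<open>Positive functionals\<close>

text \<open>The representation rests on these properties of the space alone. As
  \<open>nonneg\<close> tests only points of [0,T], values elsewhere cannot affect \<open>l\<close>;
  the bound by the supremum norm is derived from \<open>nonneg\<close> and
  \<open>const\<close>.\<close>

locale positive_functional =
  fixes V :: "(real \<Rightarrow> real) set" and l :: "(real \<Rightarrow> real) \<Rightarrow> real" and T :: real
  assumes T: "0 < T"
    and V: "subspace V"
    and const: "(\<lambda>_. 1) \<in> V"
    and ramp: "\<And>t e. 0 < e \<Longrightarrow> ramp t e \<in> V"
    and cont: "\<And>v. v \<in> V \<Longrightarrow> continuous_on {0..T} v"
    and add: "\<And>u v. u \<in> V \<Longrightarrow> v \<in> V \<Longrightarrow> l (u + v) = l u + l v"
    and scale: "\<And>c v. v \<in> V \<Longrightarrow> l (c *\<^sub>R v) = c * l v"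
    and nonneg: "\<And>v. v \<in> V \<Longrightarrow> (\<And>x. x \<in> {0..T} \<Longrightarrow> 0 \<le> v x) \<Longrightarrow> 0 \<le> l v"
begin

section \<open>Monotonicity and the bound by the supremum norm\<close>

lemma diff: "u \<in> V \<Longrightarrow> v \<in> V \<Longrightarrow> l (u - v) = l u - l v"
  using add[of "u - v" v] subspace_diff[OF V] by simp

lemma l_mono:
  assumes "u \<in> V" "v \<in> V" "\<And>x. x \<in> {0..T} \<Longrightarrow> u x \<le> v x"
  shows "l u \<le> l v"
  using nonneg[of "v - u"] diff[of v u] subspace_diff[OF V] assms by simp

lemma l_cong:
  assumes "u \<in> V" "v \<in> V" "\<And>x. x \<in> {0..T} \<Longrightarrow> u x = v x"
  shows "l u = l v"
  using assms by (intro antisym l_mono) auto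

text \<open>The constant in the supremum bound for \<open>l\<close>, and later the total mass of the
  representing measure.\<close>

definition mass :: real where "mass = l (\<lambda>_. 1)"

lemma mass_nonneg: "0 \<le> mass"
  unfolding mass_def by (rule nonneg[OF const]) simp

lemma scale_const: "(\<lambda>_. c) \<in> V" "l (\<lambda>_. c) = c * mass"
  using subspace_scale[OF V const, of c] scale[OF const, of c]
  by (simp_all add: scaleR_fun_def mass_def)

lemma l_le_add:
  assumes "u \<in> V" "v \<in> V" "\<And>x. x \<in> {0..T} \<Longrightarrow> u x \<le> v x + c"
  shows "l u \<le> l v + c * mass"
  using l_mono[of u "v + (\<lambda>_. c)"] add[OF assms(2) scale_const(1)] scale_const(2)
    subspace_add[OF V assms(2) scale_const(1)] assms by simp

lemma l_abs_diff_le: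
  assumes "u \<in> V" "v \<in> V" "\<And>x. x \<in> {0..T} \<Longrightarrow> \<bar>u x - v x\<bar> \<le> c"
  shows "\<bar>l u - l v\<bar> \<le> c * mass"
proof -
  have "u x \<le> v x + c" "v x \<le> u x + c" if "x \<in> {0..T}" for x
    using assms(3)[OF that] by linarith+
  then have "l u \<le> l v + c * mass" "l v \<le> l u + c * mass"
    using l_le_add assms(1,2) by blast+
  then show ?thesis
    by linarith
qed

lemma l_sum:
  assumes "finite I" "\<And>i. i \<in> I \<Longrightarrow> f i \<in> V"
  shows "(\<lambda>x. \<Sum>i\<in>I. c i * f i x) \<in> V \<and> l (\<lambda>x. \<Sum>i\<in>I. c i * f i x) = (\<Sum>i\<in>I. c i * l (f i))"
  using assms
proof (induction I rule: finite_induct)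
  case empty
  then show ?case
    using scale_const[of 0] by simp
next
  case (insert i I)
  let ?s = "\<lambda>x. \<Sum>i\<in>I. c i * f i x"
  have eq: "(\<lambda>x. \<Sum>i\<in>insert i I. c i * f i x) = c i *\<^sub>R f i + ?s"
    using insert.hyps by (simp add: fun_eq_iff scaleR_fun_def)
  have s: "?s \<in> V" "l ?s = (\<Sum>i\<in>I. c i * l (f i))"
    using insert.IH insert.prems by auto
  have f: "f i \<in> V" "c i *\<^sub>R f i \<in> V"
    using insert.prems subspace_scale[OF V] by auto
  show ?case
    unfolding eq using insert.hyps subspace_add[OF V f(2) s(1)] add[OF f(2) s(1)] scale[OF f(1)] s(2)
    by simp
qed

text \<open>The distribution function of the representing measure.\<close>

definition dist_fun :: "real \<Rightarrow> real" where
  "dist_fun t = (INF n. l (ramp t (1 / real (Suc n))))"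

lemma bdd_below_l_ramp: "bdd_below (range (\<lambda>n. l (ramp t (1 / real (Suc n)))))"
  by (rule bdd_belowI2[where m = 0]) (auto intro!: nonneg ramp simp: ramp_bounds)

lemma dist_fun_le: "dist_fun t \<le> l (ramp t (1 / real (Suc n)))"
  unfolding dist_fun_def by (intro cINF_lower bdd_below_l_ramp) auto

lemma l_ramp_tendsto: "(\<lambda>n. l (ramp t (1 / real (Suc n)))) \<longlonglongrightarrow> dist_fun t"
  unfolding dist_fun_def
proof (rule LIMSEQ_decseq_INF[OF bdd_below_l_ramp])
  show "decseq (\<lambda>n. l (ramp t (1 / real (Suc n))))"
    by (auto simp: decseq_def intro!: l_mono ramp ramp_mono_width divide_left_mono)
qed

lemma dist_fun_mono: "s \<le> t \<Longrightarrow> dist_fun s \<le> dist_fun t"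
  by (rule LIMSEQ_le[OF l_ramp_tendsto l_ramp_tendsto]) (auto intro!: exI l_mono ramp ramp_mono_left)

lemma dist_fun_neg:
  assumes "t < 0"
  shows "dist_fun t = 0"
proof (rule antisym)
  \<comment> \<open>A ramp of width below \<open>- t\<close> has dropped to 0 before it reaches
    [0,T], so \<open>l\<close> sees the zero function.\<close>
  obtain n where n: "1 / real (Suc n) < - t"
    using assms nat_approx_posE[of "- t"] by auto
  have "l (ramp t (1 / real (Suc n))) = l (\<lambda>_. 0)"
    using n assms by (intro l_cong ramp scale_const) (auto simp: ramp_def)
  then show "dist_fun t \<le> 0"
    using dist_fun_le[of t n] scale_const(2)[of 0] by simp
  show "0 \<le> dist_fun t"
    by (rule LIMSEQ_le_const[OF l_ramp_tendsto]) (auto intro!: exI nonneg ramp simp: ramp_bounds)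
qed

lemma dist_fun_ge:
  assumes "T \<le> t"
  shows "dist_fun t = mass"
proof -
  have "l (ramp t e) = mass" if "0 < e" for e
    unfolding mass_def using assms that by (intro l_cong ramp const) (auto simp: ramp_def)
  then show ?thesis
    by (simp add: dist_fun_def)
qed

text \<open>A ramp at \<open>a\<close> whose value is within \<epsilon>/2 of
  \<open>dist_fun a\<close> is shifted right by \<delta>. The value at the shifted ramp bounds
  \<open>dist_fun (a + \<delta>)\<close> and exceeds the old one by at most
  \<open>\<delta> / e * mass\<close>.\<close>

lemma dist_fun_right_cont: "continuous (at_right a) dist_fun"
proof (subst continuous_at_right_real_increasing)
  show "\<And>x y. x \<le> y \<Longrightarrow> dist_fun x \<le> dist_fun y"
    by (rule dist_fun_mono)
  show "\<forall>\<epsilon>>0. \<exists>\<delta>>0. dist_fun (a + \<delta>) - dist_fun a < \<epsilon>"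
  proof (intro allI impI)
    fix \<epsilon> :: real assume \<epsilon>: "0 < \<epsilon>"
    have "eventually (\<lambda>n. l (ramp a (1 / real (Suc n))) < dist_fun a + \<epsilon> / 2) sequentially"
      using \<epsilon> by (intro order_tendstoD[OF l_ramp_tendsto]) auto
    then obtain n where n: "l (ramp a (1 / real (Suc n))) < dist_fun a + \<epsilon> / 2"
      by (auto simp: eventually_sequentially)
    define e where "e = 1 / real (Suc n)"
    \<comment> \<open>Makes the cost of the shift at most \<epsilon>/2; the summand 1 covers the
      case \<open>mass = 0\<close>.\<close>
    define \<delta> where "\<delta> = e * \<epsilon> / (2 * (mass + 1))"
    have e: "0 < e"
      by (simp add: e_def)
    then have \<delta>: "0 < \<delta>"
      using \<epsilon> mass_nonneg by (simp add: \<delta>_def)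
    have "dist_fun (a + \<delta>) \<le> l (ramp (a + \<delta>) e)"
      unfolding e_def by (rule dist_fun_le)
    also have "\<dots> \<le> l (ramp a e) + \<delta> / e * mass"
      using e \<delta> by (intro l_le_add ramp ramp_shift_le) auto
    also have "\<delta> / e * mass \<le> \<epsilon> / 2"
    proof -
      have "\<delta> / e * mass = (\<epsilon> / 2) * (mass / (mass + 1))"
        using e mass_nonneg by (simp add: \<delta>_def)
      also have "\<dots> \<le> (\<epsilon> / 2) * 1"
        using \<epsilon> mass_nonneg by (intro mult_left_mono) auto
      finally show ?thesis
        by simp
    qed
    finally show "\<exists>\<delta>>0. dist_fun (a + \<delta>) - dist_fun a < \<epsilon>"
      using n \<delta> by (intro exI[of _ \<delta>]) (auto simp: e_def)
  qed
qed

section \<open>The Stieltjes measure of \<open>dist_fun\<close> and its concentration on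
  [0,T]\<close>

definition line_measure :: "real measure" where
  "line_measure = interval_measure dist_fun"

lemma sets_line_measure [simp, measurable_cong]: "sets line_measure = sets borel"
  by (simp add: line_measure_def)

lemma space_line_measure [simp]: "space line_measure = UNIV"
  by (simp add: line_measure_def)

lemma emeasure_line_measure:
  "a \<le> b \<Longrightarrow> emeasure line_measure {a<..b} = ennreal (dist_fun b - dist_fun a)"
  unfolding line_measure_def
  by (rule emeasure_interval_measure_Ioc) (auto intro: dist_fun_mono dist_fun_right_cont)

text \<open>The complement of [0,T] is a countable union of half-open intervals on which
  \<open>dist_fun\<close> is constant.\<close>

lemma AE_line_measure: "AE x in line_measure. x \<in> {0..T}"
proof -
  \<comment> \<open>The right ends stay strictly below 0, since 0 may carry an atom.\<close>
  have "(\<Union>n. {- real n - 1<..- (1 / real (Suc n))}) \<in> null_sets line_measure"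
  proof (rule null_sets_UN)
    fix n
    have "- real n - 1 \<le> - (1 / real (Suc n))"
      by (simp add: field_simps)
    then have "emeasure line_measure {- real n - 1<..- (1 / real (Suc n))} = 0"
      by (simp add: emeasure_line_measure dist_fun_neg)
    then show "{- real n - 1<..- (1 / real (Suc n))} \<in> null_sets line_measure"
      by (simp add: null_sets_def)
  qed
  moreover have "(\<Union>n. {T<..T + real n}) \<in> null_sets line_measure"
    by (rule null_sets_UN) (simp add: null_sets_def emeasure_line_measure dist_fun_ge)
  ultimately have "AE x in line_measure. x \<notin> (\<Union>n. {- real n - 1<..- (1 / real (Suc n))})"
    "AE x in line_measure. x \<notin> (\<Union>n. {T<..T + real n})"
    using AE_not_in by blast+
  then show ?thesis
  proof eventually_elim
    case (elim x)
    have "0 \<le> x"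
    proof (rule ccontr)
      assume x: "\<not> 0 \<le> x"
      obtain m where m: "1 / real (Suc m) < - x"
        using x nat_approx_posE[of "- x"] by auto
      obtain k where k: "- x < real k"
        using reals_Archimedean2 by blast
      \<comment> \<open>One index has to serve both end points, hence the maximum.\<close>
      have "1 / real (Suc (max m k)) \<le> 1 / real (Suc m)"
        by (intro divide_left_mono) auto
      then have "x \<in> {- real (max m k) - 1<..- (1 / real (Suc (max m k)))}"
        using m k by auto
      with elim(1) show False
        by blast
    qed
    moreover obtain k where "x - T < real k"
      using reals_Archimedean2 by blast
    then have "x \<le> T"
      using elim(2) by (auto simp: not_less dest!: spec[of _ k])
    ultimately show ?case
      by simp
  qed
qed

lemma emeasure_line_measure_UNIV: "emeasure line_measure UNIV = ennreal mass"
proof -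
  \<comment> \<open>Starting left of 0 keeps an atom at 0 inside the half-open interval.\<close>
  have "emeasure line_measure UNIV = emeasure line_measure {-1<..T}"
  proof (rule emeasure_eq_AE)
    show "AE x in line_measure. x \<in> UNIV \<longleftrightarrow> x \<in> {-1<..T}"
      using AE_line_measure by eventually_elim auto
  qed auto
  also have "\<dots> = ennreal mass"
    using T by (simp add: emeasure_line_measure dist_fun_neg dist_fun_ge)
  finally show ?thesis .
qed

lemma finite_line_measure: "finite_measure line_measure"
  by (rule finite_measureI) (simp add: emeasure_line_measure_UNIV)

text \<open>Counterpart of \<open>l_abs_diff_le\<close> with the same constant; closeness on [0,T]
  suffices because the measure is concentrated there.\<close>

lemma integral_line_measure_close:
  assumes "integrable line_measure f" "integrable line_measure g"
    and "\<And>x. x \<in> {0..T} \<Longrightarrow> \<bar>f x - g x\<bar> \<le> c"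
  shows "\<bar>(LINT x|line_measure. f x) - (LINT x|line_measure. g x)\<bar> \<le> c * mass"
proof -
  interpret finite_measure line_measure
    by (rule finite_line_measure)
  have "\<bar>LINT x|line_measure. f x - g x\<bar> \<le> (LINT x|line_measure. \<bar>f x - g x\<bar>)"
    by (rule integral_abs_bound)
  also have "\<dots> \<le> (LINT x|line_measure. c)"
  proof (rule integral_mono_AE)
    show "AE x in line_measure. \<bar>f x - g x\<bar> \<le> c"
      using AE_line_measure by eventually_elim (rule assms(3))
  qed (use assms in auto)
  also have "\<dots> = c * mass"
    using mass_nonneg by (simp add: measure_def emeasure_line_measure_UNIV)
  finally show ?thesis
    using assms(1,2) by simp
qed

section \<open>Approximation by combinations of ramps\<close>

text \<open>
  With \<open>n\<close> equal cells the nodes are \<open>i T / n\<close>, preceded by \<open>-1\<close> so that the first cell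
  \<open>{-1<..0}\<close> captures a possible atom at \<open>0\<close>.
\<close>

definition node :: "nat \<Rightarrow> nat \<Rightarrow> real" where
  "node n i = (case i of 0 \<Rightarrow> - 1 | Suc j \<Rightarrow> real j * T / real n)"

text \<open>There are \<open>n + 1\<close> terms, index 0 belonging to the extra cell. For
  \<open>e = 0\<close> this is on [0,T] the step function with the value of \<open>v\<close> at the
  right end of each cell; for \<open>e > 0\<close> it is a continuous substitute lying in
  \<open>V\<close>.\<close>

definition step :: "nat \<Rightarrow> (real \<Rightarrow> real) \<Rightarrow> real \<Rightarrow> real \<Rightarrow> real" where
  "step n v e x = (\<Sum>i\<le>n. v (node n (Suc i)) * (ramp (node n (Suc i)) e x - ramp (node n i) e x))"

lemma node_mono: "node n i \<le> node n (Suc i)"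
  using T by (cases i) (auto simp: node_def divide_right_mono)

text \<open>On [0,T] the ramp differences are non-negative weights with sum 1, so the error is an
  average of \<open>v x - v (node n (Suc i))\<close>, and a weight is nonzero only for nodes within
  \<open>T / n\<close> of \<open>x\<close>. Admitting \<open>e = 0\<close> treats the integral and
  the functional alike.\<close>

lemma step_close:
  assumes "0 < n" "0 \<le> e" "e < T / real n" "e < 1"
    and unif: "\<And>x y. x \<in> {0..T} \<Longrightarrow> y \<in> {0..T} \<Longrightarrow> \<bar>x - y\<bar> \<le> T / real n \<Longrightarrow> \<bar>v x - v y\<bar> \<le> c"
    and x: "x \<in> {0..T}"
  shows "\<bar>v x - step n v e x\<bar> \<le> c"
proof -
  let ?w = "\<lambda>i. ramp (node n (Suc i)) e x - ramp (node n i) e x"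
  have w: "0 \<le> ?w i" for i
    using ramp_mono_left[OF node_mono assms(2)] by simp
  have "(\<Sum>i\<le>n. ?w i) = (\<Sum>i<Suc n. ramp (node n (Suc i)) e x - ramp (node n i) e x)"
    by (simp add: lessThan_Suc_atMost)
  also have "\<dots> = ramp T e x - ramp (- 1) e x"
    using assms(1) by (subst sum_lessThan_telescope) (simp add: node_def)
  \<comment> \<open>The ramp at the last node \<open>T\<close> is 1 on [0,T], and the one at
    \<open>- 1\<close> vanishes there because \<open>e < 1\<close>.\<close>
  also have "\<dots> = 1"
    using assms x by (simp add: ramp_def)
  finally have w1: "(\<Sum>i\<le>n. ?w i) = 1" .
  have "\<bar>v x - v (node n (Suc i))\<bar> * ?w i \<le> c * ?w i" if i: "i \<le> n" for i
  proof (cases "?w i = 0")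
    case False
    \<comment> \<open>Outside the range given by \<open>less\<close> and \<open>greater\<close> both
      ramps are 1 or both are 0.\<close>
    have less: "node n i < x"
      using False node_mono[of n i] by (cases "node n i < x") (auto simp: ramp_def)
    have greater: "x \<le> node n (Suc i) + e"
      using False node_mono[of n i] assms(2)
      by (cases "x \<le> node n (Suc i) + e") (auto simp: ramp_def)
    have "node n (Suc i) \<in> {0..T}"
      using i T assms(1) by (auto simp: node_def field_simps)
    moreover have "\<bar>x - node n (Suc i)\<bar> \<le> T / real n"
    \<comment> \<open>The extra cell has length 1 instead of \<open>T / n\<close>, but there
      \<open>x\<close> lies between 0 and \<open>e\<close>.\<close>
    proof (cases i)
      case 0
      then show ?thesis
        using greater x assms(3) by (simp add: node_def)
    next
      case (Suc j)
      then have "node n (Suc i) = node n i + T / real n"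
        by (simp add: node_def field_simps add_divide_distrib)
      then show ?thesis
        using less greater assms(3) by linarith
    qed
    ultimately show ?thesis
      using unif[OF x] w by (intro mult_right_mono) auto
  qed simp
  then have "(\<Sum>i\<le>n. \<bar>v x - v (node n (Suc i))\<bar> * ?w i) \<le> (\<Sum>i\<le>n. c * ?w i)"
    by (intro sum_mono) auto
  also have "\<dots> = c"
    by (simp add: sum_distrib_left[symmetric] w1)
  finally have le: "(\<Sum>i\<le>n. \<bar>v x - v (node n (Suc i))\<bar> * ?w i) \<le> c" .
  have "v x - step n v e x = v x * (\<Sum>i\<le>n. ?w i) - step n v e x"
    by (simp add: w1)
  also have "\<dots> = (\<Sum>i\<le>n. (v x - v (node n (Suc i))) * ?w i)"
    by (simp add: step_def sum_distrib_left sum_subtractf[symmetric] left_diff_distrib)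
  finally have "\<bar>v x - step n v e x\<bar> \<le> (\<Sum>i\<le>n. \<bar>(v x - v (node n (Suc i))) * ?w i\<bar>)"
    by simp
  also have "\<dots> = (\<Sum>i\<le>n. \<bar>v x - v (node n (Suc i))\<bar> * ?w i)"
    using w by (simp add: abs_mult)
  finally show ?thesis
    using le by linarith
qed

lemma step_in_V:
  assumes "0 < e"
  shows "step n v e \<in> V"
    and "l (step n v e) = (\<Sum>i\<le>n. v (node n (Suc i)) * (l (ramp (node n (Suc i)) e) - l (ramp (node n i) e)))"
proof -
  let ?f = "\<lambda>i. ramp (node n (Suc i)) e - ramp (node n i) e"
  have f: "?f i \<in> V" "l (?f i) = l (ramp (node n (Suc i)) e) - l (ramp (node n i) e)" for i
    using ramp[OF assms] diff subspace_diff[OF V] by auto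
  have eq: "step n v e = (\<lambda>x. \<Sum>i\<le>n. v (node n (Suc i)) * ?f i x)"
    by (simp add: fun_eq_iff step_def)
  show "step n v e \<in> V"
    and "l (step n v e) = (\<Sum>i\<le>n. v (node n (Suc i)) * (l (ramp (node n (Suc i)) e) - l (ramp (node n i) e)))"
    unfolding eq using l_sum[of "{..n}" ?f "\<lambda>i. v (node n (Suc i))"] f by auto
qed

text \<open>At width 0 the ramp differences are indicators of half-open cells. The sum is the one
  for \<open>l (step n v e)\<close> in \<open>step_in_V\<close> with ramp values replaced by their
  limits, which links the functional to the measure.\<close>

lemma integral_step_0:
  "integrable line_measure (step n v 0)"
  "(LINT x|line_measure. step n v 0 x)
    = (\<Sum>i\<le>n. v (node n (Suc i)) * (dist_fun (node n (Suc i)) - dist_fun (node n i)))"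
proof -
  have eq: "step n v 0 = (\<lambda>x. \<Sum>i\<le>n. v (node n (Suc i)) * indicator {node n i<..node n (Suc i)} x)"
    unfolding step_def ramp_0 fun_eq_iff
    using node_mono[of n] by (intro allI sum.cong) (auto simp: indicator_def intro: order_trans)
  have int: "integrable line_measure (indicat_real {node n i<..node n (Suc i)})" for i
    by (intro integrable_real_indicator) (auto simp: emeasure_line_measure node_mono)
  show "integrable line_measure (step n v 0)"
    unfolding eq by (intro Bochner_Integration.integrable_sum integrable_mult_right int)
  have "measure line_measure {node n i<..node n (Suc i)} = dist_fun (node n (Suc i)) - dist_fun (node n i)" for i
    using dist_fun_mono[OF node_mono[of n i]] by (simp add: measure_def emeasure_line_measure node_mono)
  then show "(LINT x|line_measure. step n v 0 x)
    = (\<Sum>i\<le>n. v (node n (Suc i)) * (dist_fun (node n (Suc i)) - dist_fun (node n i)))"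
    unfolding eq by (subst Bochner_Integration.integral_sum) (auto intro: int)
qed

section \<open>Passage to the limit and the representing measure\<close>

lemma integrable_line_measure:
  assumes "v \<in> V"
  shows "integrable line_measure (\<lambda>x. indicator {0..T} x * v x)"
proof -
  interpret finite_measure line_measure
    by (rule finite_line_measure)
  have "compact (v ` {0..T})"
    by (intro compact_continuous_image cont assms) auto
  then obtain B where B: "\<And>x. x \<in> {0..T} \<Longrightarrow> \<bar>v x\<bar> \<le> B"
    by (force dest!: compact_imp_bounded simp: bounded_iff)
  \<comment> \<open>Outside [0,T] nothing is known about \<open>v\<close>, so measurability is shown
    for the cut-off function.\<close>
  have "(\<lambda>x. indicator {0..T} x *\<^sub>R v x) \<in> borel_measurable borel"
    by (intro borel_measurable_continuous_on_indicator cont assms) auto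
  then have "(\<lambda>x. indicator {0..T} x * v x) \<in> borel_measurable line_measure"
    by (simp add: measurable_cong_sets[OF sets_line_measure refl])
  moreover have "AE x in line_measure. norm (indicator {0..T} x * v x) \<le> B"
    using AE_line_measure by eventually_elim (use B in auto)
  ultimately show ?thesis
    by (intro integrable_const_bound)
qed

text \<open>The integral of \<open>step n v 0\<close> is the intermediary: \<open>l v\<close> and
  the integral of \<open>v\<close> both lie within \<open>c * mass\<close> of it, where
  \<open>c\<close> bounds the oscillation of \<open>v\<close> at distance
  \<open>T / n\<close>.\<close>

lemma l_eq_integral:
  assumes v: "v \<in> V"
  shows "l v = (LINT x|line_measure. indicator {0..T} x * v x)"
proof -
  let ?I = "LINT x|line_measure. indicator {0..T} x * v x"
  have bound: "\<bar>l v - ?I\<bar> \<le> 2 * c * mass" if c: "0 < c" for c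
  proof -
    have "uniformly_continuous_on {0..T} v"
      by (intro compact_uniformly_continuous cont v) auto
    then obtain \<delta> where \<delta>: "0 < \<delta>"
      and unif: "\<And>x y. x \<in> {0..T} \<Longrightarrow> y \<in> {0..T} \<Longrightarrow> \<bar>x - y\<bar> < \<delta> \<Longrightarrow> \<bar>v x - v y\<bar> < c"
      using c unfolding uniformly_continuous_on_def dist_real_def by metis
    obtain n where n: "T / \<delta> < real n"
      using reals_Archimedean2 by blast
    then have n0: "0 < n"
      using T \<delta> by (metis divide_pos_pos gr0I not_less_iff_gr_or_eq of_nat_0 order_less_trans)
    have Tn: "T / real n < \<delta>"
      using n n0 \<delta> by (simp add: field_simps)
    have unif': "\<bar>v x - v y\<bar> \<le> c" if "x \<in> {0..T}" "y \<in> {0..T}" "\<bar>x - y\<bar> \<le> T / real n" for x y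
      using unif[OF that(1,2)] that(3) Tn by linarith
    have "0 < min 1 (T / real n)"
      using T n0 by simp
    \<comment> \<open>From this index on, the widths \<open>1 / real (Suc k)\<close> satisfy the
      hypotheses of \<open>step_close\<close>.\<close>
    then obtain N where N: "1 / real (Suc N) < min 1 (T / real n)"
      using nat_approx_posE by metis
    have "\<bar>?I - (LINT x|line_measure. step n v 0 x)\<bar> \<le> c * mass"
    proof (intro integral_line_measure_close integrable_line_measure v integral_step_0)
      fix x assume x: "x \<in> {0..T}"
      have "\<bar>v x - step n v 0 x\<bar> \<le> c"
        using T n0 x by (intro step_close[OF _ _ _ _ unif']) auto
      with x show "\<bar>indicator {0..T} x * v x - step n v 0 x\<bar> \<le> c"
        by simp
    qed
    \<comment> \<open>With \<open>n\<close> fixed the sum is finite and converges termwise as the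
      width shrinks, while the uniform bound persists.\<close>
    moreover have "\<bar>l v - (LINT x|line_measure. step n v 0 x)\<bar> \<le> c * mass"
    proof (rule Lim_bounded)
      show "(\<lambda>k. \<bar>l v - l (step n v (1 / real (Suc k)))\<bar>)
          \<longlonglongrightarrow> \<bar>l v - (LINT x|line_measure. step n v 0 x)\<bar>"
        unfolding integral_step_0 by (simp only: step_in_V(2) of_nat_0_less_iff zero_less_divide_1_iff zero_less_Suc)
          (intro tendsto_intros l_ramp_tendsto)
      show "\<forall>k\<ge>N. \<bar>l v - l (step n v (1 / real (Suc k)))\<bar> \<le> c * mass"
      proof (intro allI impI)
        fix k assume "N \<le> k"
        then have "1 / real (Suc k) \<le> 1 / real (Suc N)"
          by (intro divide_left_mono) auto
        with N have k: "1 / real (Suc k) < T / real n" "1 / real (Suc k) < 1"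
          by linarith+
        show "\<bar>l v - l (step n v (1 / real (Suc k)))\<bar> \<le> c * mass"
          by (intro l_abs_diff_le v step_in_V step_close[OF n0 _ k unif']) auto
      qed
    qed
    ultimately show ?thesis
      by linarith
  qed
  have "\<bar>l v - ?I\<bar> \<le> 0 + e" if e: "0 < e" for e
  proof -
    have "2 * (e / (2 * (mass + 1))) * mass = e * (mass / (mass + 1))"
      using mass_nonneg by (simp add: field_simps)
    also have "\<dots> \<le> e * 1"
      using e mass_nonneg by (intro mult_left_mono) auto
    finally show ?thesis
      using bound[of "e / (2 * (mass + 1))"] e mass_nonneg by simp
  qed
  then have "\<bar>l v - ?I\<bar> \<le> 0"
    by (rule field_le_epsilon)
  then show ?thesis
    by simp
qed

text \<open>A finite Borel measure on the line is inner regular. Restriction to [0,T] keeps the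
  measures of subsets and turns the cut-off integrand into \<open>v\<close>.\<close>

theorem representation:
  "\<exists>m. radon_measure_on {0..T} m \<and> (\<forall>v\<in>V. l v = (LINT t|m. v t))"
proof (intro exI conjI ballI)
  let ?m = "restrict_space line_measure {0..T}"
  have em: "emeasure ?m A = emeasure line_measure A" if "A \<subseteq> {0..T}" for A
    using that by (intro emeasure_restrict_space) auto
  have fin: "emeasure line_measure A \<noteq> \<infinity>" for A
    by (rule finite_measure.emeasure_finite[OF finite_line_measure, unfolded infinity_ennreal_def[symmetric]])
  show "radon_measure_on {0..T} ?m"
    unfolding radon_measure_on_def
  proof (intro conjI allI impI ballI)
    show "sets ?m = sets (restrict_space borel {0..T})"
      by (intro sets_restrict_space_cong) simp
    show "emeasure ?m C < \<infinity>" if "compact C \<and> C \<subseteq> {0..T}" for C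
      using that em[of C] fin[of C] by (simp add: less_top)
    fix B assume "B \<in> sets ?m"
    then have B: "B \<subseteq> {0..T}" "B \<in> sets borel"
      by (auto simp: sets_restrict_space_iff)
    have "emeasure line_measure B = (SUP C\<in>{C. C \<subseteq> B \<and> compact C}. emeasure line_measure C)"
      using fin B(2) by (intro inner_regular) auto
    then show "emeasure ?m B = (SUP C\<in>{C. compact C \<and> C \<subseteq> B}. emeasure ?m C)"
      using B(1) em by (auto simp: conj_commute intro!: SUP_cong)
  qed
  show "l v = (LINT t|?m. v t)" if "v \<in> V" for v
    using l_eq_integral[OF that] by (subst integral_restrict_space) auto
qed

end

section \<open>The multiplier as a positive functional\<close>

theorem proposition5p7:
  fixes d :: problem
    and \<gamma> :: "real \<Rightarrow> real^2" and \<tau> :: real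
    and lam :: "(real \<Rightarrow> real) \<Rightarrow> real" and \<mu> :: real
  assumes "standing_assumptions d"
    and "\<gamma> \<in> U_ad d"
    and "\<tau> \<in> {3 * win_length d .. final_time d}"
    and "lagrange_multiplier d \<gamma> \<tau> lam \<mu>"
  shows "\<exists>m :: real measure. radon_measure_on {0..final_time d} m \<and>
           (\<forall>v\<in>H1_interval (final_time d). lam v = (LINT t|m. v t))"
proof -
  let ?T = "final_time d"
  have T: "0 < ?T"
    using assms(1) by (simp add: standing_assumptions_def)
  let ?G = "path_constraint d \<gamma>"
  have dual: "lam \<in> dual (H1_interval ?T) (H1_interval_norm ?T)"
    and G: "?G \<in> nonpos_cone d"
    and cone: "\<And>z. z \<in> nonpos_cone d \<Longrightarrow> lam (z - ?G) \<le> 0"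
    using assms(4) by (auto simp: lagrange_multiplier_def normal_cone_def Let_def)
  have lin: "lam (u + v) = lam u + lam v" "lam (c *\<^sub>R v) = c * lam v"
    if "u \<in> H1_interval ?T" "v \<in> H1_interval ?T" for u v c
    using dual that by (auto simp: dual_def bounded_linear_between_def)
  have sub: "subspace (H1_interval ?T :: (real \<Rightarrow> real) set)"
    using T by (intro subspace_H1_interval) simp
  interpret positive_functional "H1_interval ?T" lam ?T
  proof
    fix v :: "real \<Rightarrow> real"
    assume v: "v \<in> H1_interval ?T" "\<And>x. x \<in> {0..?T} \<Longrightarrow> 0 \<le> v x"
    have "?G - v \<in> nonpos_cone d"
      using G v subspace_diff[OF sub] by (force simp: nonpos_cone_def)
    \<comment> \<open>The increment from \<open>?G\<close> to the test point \<open>?G - v\<close>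
      is \<open>- v\<close>.\<close>
    then have "lam (- 1 *\<^sub>R v) \<le> 0"
      using cone by fastforce
    then show "0 \<le> lam v"
      using lin(2)[OF v(1) v(1), of "- 1"] by simp
  next
    fix v :: "real \<Rightarrow> real" assume "v \<in> H1_interval ?T"
    then show "continuous_on {0..?T} v"
      by (simp add: H1_interval_def)
  qed (use T sub lin in \<open>auto intro: const_in_H1_interval ramp_in_H1_interval\<close>)
  show ?thesis
    by (rule representation)
qed

end
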